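(* Let $\Theta_L=\{\hat x_l\in S^2\,|\,l=1,2,\dots,L\}$ be a set of $L$ observation directions, and consider an array of $M$ dipoles $(z_m,q_m)$, $1\le m\le M$, the first $M_1$ of which are magnetic dipoles and the other $M-M_1$ of which are electric dipoles. If any three directions in $\Theta_L$ are not coplanar and $L\ge\max\{4M_1,\,4(M-M_1)\}$, then the two sets $$\{(z_m,q_m)\,|\,1\le m\le M_1\}\quad\text{and}\quad\{(z_m,q_m)\,|\,M_1<m\le M\}$$ are uniquely determined by the multi-frequency electric far field patterns $E^\infty(\pm\hat x,k)$, $\hat x\in\Theta_L$, $k\in(0,\infty)$.
   Context: $S^2=\{x\in\mathbb{R}^3:|x|=1\}$. The $m$-th dipole has location $z_m\in\mathbb{R}^3$ and polarization strength $q_m=\tau_m p_m\in\mathbb{C}^3$, the product of the strength $\tau_m\in\mathbb{C}$ and the polarization direction $p_m\in S^2$. The electric far field pattern of the array at direction $\hat x\in S^2$ and wave number $k>0$ is $$E^\infty(\hat x,k)=\sum_{m=1}^{M_1}\frac{ik}{4\pi}e^{-ik\hat x\cdot z_m}\,\hat x\times q_m+\sum_{m=M_1+1}^{M}\frac{ik}{4\pi}e^{-ik\hat x\cdot z_m}\,\hat x\times(q_m\times\hat x).$$ The inverse problem is to determine the locations, the polarization strengths and the type (magnetic or electric) of the dipoles from the far field data.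
   Formalization: Uniqueness is proved among arrays whose dipole strengths are all nonzero and whose locations are distinct within each type (magnetic, electric); without this the claim fails, since void dipoles are invisible and same-type dipoles at one point merge. *)

theory Defs
  imports "HOL-Analysis.Analysis"
begin

definition complex_vec :: "real^3 \<Rightarrow> complex^3" where
  "complex_vec x = (\<chi> i. complex_of_real (x $ i))"

(* Complex-bilinear extension of cross3 (same coordinate formula, no conjugation). *)
definition ccross3 :: "complex^3 \<Rightarrow> complex^3 \<Rightarrow> complex^3" where
  "ccross3 a b = vector [a$2 * b$3 - a$3 * b$2,
                         a$3 * b$1 - a$1 * b$3,
                         a$1 * b$2 - a$2 * b$1]"

definition polarization_strength ::
    "(nat \<Rightarrow> complex) \<Rightarrow> (nat \<Rightarrow> real^3) \<Rightarrow> nat \<Rightarrow> complex^3" where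
  "polarization_strength \<tau> p m = \<tau> m *s complex_vec (p m)"

(* Dipoles are indexed from 1; those with index 1..M1 are magnetic, those with index
   M1+1..M are electric.  No dipole is void (nonzero strengths), and the locations are
   distinct among dipoles of the same type: otherwise dipoles could be absent from the
   field or merge with one another.  A magnetic and an electric dipole may share a location. *)
definition dipole_array ::
    "nat \<Rightarrow> nat \<Rightarrow> (nat \<Rightarrow> real^3) \<Rightarrow> (nat \<Rightarrow> complex) \<Rightarrow> (nat \<Rightarrow> real^3) \<Rightarrow> bool" where
  "dipole_array M1 M z \<tau> p \<longleftrightarrow>
     M1 \<le> M \<and>
     (\<forall>m\<in>{1..M}. \<tau> m \<noteq> 0 \<and> p m \<in> sphere 0 1) \<and>
     inj_on z {1..M1} \<and> inj_on z {M1<..M}"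

definition far_field ::
    "nat \<Rightarrow> nat \<Rightarrow> (nat \<Rightarrow> real^3) \<Rightarrow> (nat \<Rightarrow> complex^3) \<Rightarrow> real^3 \<Rightarrow> real \<Rightarrow> complex^3" where
  "far_field M1 M z q x k =
     (\<Sum>m\<in>{1..M1}.
        (\<i> * complex_of_real k / (4 * complex_of_real pi)
          * exp (- \<i> * complex_of_real (k * (x \<bullet> z m))))
        *s ccross3 (complex_vec x) (q m))
   + (\<Sum>m\<in>{M1<..M}.
        (\<i> * complex_of_real k / (4 * complex_of_real pi)
          * exp (- \<i> * complex_of_real (k * (x \<bullet> z m))))
        *s ccross3 (complex_vec x) (ccross3 (q m) (complex_vec x)))"

(* Directions are coplanar when, as vectors, they lie in a common plane through the origin;
   three points alone are always affinely coplanar, hence the 0. *)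
definition no_three_coplanar :: "(real^3) set \<Rightarrow> bool" where
  "no_three_coplanar \<Theta> \<longleftrightarrow>
     (\<forall>u\<in>\<Theta>. \<forall>v\<in>\<Theta>. \<forall>w\<in>\<Theta>. u \<noteq> v \<and> u \<noteq> w \<and> v \<noteq> w \<longrightarrow> \<not> coplanar {0, u, v, w})"

end

theory Submission
  imports Defs
begin

text \<open>
  For a fixed direction \<open>x\<close> the far field is a combination of the exponentials
  \<open>exp (- i k (x \<bullet> y))\<close>, which are linearly independent as functions of \<open>k > 0\<close>. Hence the data
  at \<open>x\<close> determine, for every \<open>s\<close>, the sum of the amplitudes over all locations \<open>y\<close> with
  \<open>x \<bullet> y = s\<close>. Passing from \<open>x\<close> to \<open>- x\<close> flips the sign of the magnetic amplitude only, so the two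
  types separate. For each type, consider the difference of two arrays with the same data. It
  is supported on at most half as many points as there are directions, and any two of these
  points have the same projection in at most two directions. Thus each point of the support is
  isolated by at least two independent directions, and its strength, being parallel to both,
  vanishes.
\<close>

section \<open>Linear independence of exponentials on the positive half-line\<close>

text \<open>Induction on the set of frequencies: a shift of \<open>k\<close> by \<open>h\<close>
  multiplies each exponential by its own constant, so one frequency can be eliminated. The
  elimination changes the coefficients, hence \<open>c\<close> is arbitrary.\<close>

lemma exp_sum_distinct_eq_0:
  fixes c :: "real \<Rightarrow> complex"
  assumes "finite S" and "\<And>k. k > 0 \<Longrightarrow> (\<Sum>s\<in>S. c s * exp (- \<i> * of_real (k * s))) = 0"
    and "s \<in> S"
  shows "c s = 0"
  using assms
proof (induction S arbitrary: c s rule: finite_induct)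
  case empty
  then show ?case by simp
next
  case (insert a S)
  let ?e = "\<lambda>k s. exp (- \<i> * of_real (k * s)) :: complex"
  have e_add: "?e (k + h) t = ?e h t * ?e k t" for k h t
    by (simp add: algebra_simps flip: exp_add)
  (* The difference F (k + h) - ?e h a * F k no longer contains the frequency a. *)
  have c_S: "c t = 0" if t: "t \<in> S" for t
  proof -
    have "t \<noteq> a" using t insert.hyps by auto
    \<comment> \<open>This shift makes the factors of \<open>t\<close> and \<open>a\<close> differ
      by the sign -1, so the new coefficient of \<open>t\<close> vanishes only if \<open>c t\<close>
      does. Being positive, it keeps \<open>k + h\<close> in the range of the hypothesis.\<close>
    define h where "h = pi / \<bar>t - a\<bar>"
    have h: "h > 0" using \<open>t \<noteq> a\<close> by (simp add: h_def)
    have "c t * (?e h t - ?e h a) = 0"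
    proof (rule insert.IH[OF _ t])
      fix k :: real assume k: "k > 0"
      have sums: "(\<Sum>s\<in>S. c s * ?e k' s) = - (c a * ?e k' a)" if "k' > 0" for k'
        using insert.prems(1)[OF that] insert.hyps by (simp add: add_eq_0_iff)
      have "(\<Sum>s\<in>S. c s * (?e h s - ?e h a) * ?e k s)
          = (\<Sum>s\<in>S. c s * ?e (k + h) s) - ?e h a * (\<Sum>s\<in>S. c s * ?e k s)"
        unfolding e_add sum_distrib_left sum_subtractf[symmetric]
        by (intro sum.cong refl) (simp only: ring_distribs mult.assoc mult.left_commute)
      also have "\<dots> = - (c a * ?e (k + h) a) - ?e h a * - (c a * ?e k a)"
        using k h by (simp only: sums add_pos_pos)
      also have "\<dots> = 0" unfolding e_add by (simp only: mult_minus_right mult.left_commute) simp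
      finally show "(\<Sum>s\<in>S. c s * (?e h s - ?e h a) * ?e k s) = 0" .
    qed
    moreover have "?e h t \<noteq> ?e h a"
    proof -
      have "h * (t - a) = pi \<or> h * (t - a) = - pi"
        using \<open>t \<noteq> a\<close> by (cases "t > a") (simp_all add: h_def field_simps)
      then have "?e h (t - a) = -1"
        by (elim disjE) (simp_all only: of_real_minus, simp_all add: exp_minus)
      moreover have "?e h t = ?e h (t - a) * ?e h a"
        by (simp add: algebra_simps flip: exp_add)
      ultimately show ?thesis by simp
    qed
    ultimately show ?thesis by simp
  qed
  show ?case
  proof (cases "s = a")
    case True
    have "(\<Sum>s\<in>S. c s * ?e 1 s) = 0" by (rule sum.neutral) (simp add: c_S)
    then show ?thesis using insert.prems(1)[of 1] insert.hyps True by simp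
  qed (use insert.prems c_S in auto)
qed

text \<open>Indices with equal \<open>t j\<close> share a frequency, so only the sums of their
  coefficients can be recovered; grouping by the value of \<open>t\<close> reduces to distinct
  frequencies.\<close>

lemma exp_sum_eq_0:
  fixes t :: "'a \<Rightarrow> real" and c :: "'a \<Rightarrow> complex"
  assumes "finite I" and "\<And>k. k > 0 \<Longrightarrow> (\<Sum>j\<in>I. c j * exp (- \<i> * of_real (k * t j))) = 0"
  shows "(\<Sum>j | j \<in> I \<and> t j = s. c j) = 0"
proof (cases "s \<in> t ` I")
  case True
  have "(\<Sum>s\<in>t ` I. (\<Sum>j | j \<in> I \<and> t j = s. c j) * exp (- \<i> * of_real (k * s))) = 0"
    if "k > 0" for k
  proof -
    have "(\<Sum>s\<in>t ` I. (\<Sum>j | j \<in> I \<and> t j = s. c j) * exp (- \<i> * of_real (k * s)))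
        = (\<Sum>s\<in>t ` I. \<Sum>j | j \<in> I \<and> t j = s. c j * exp (- \<i> * of_real (k * t j)))"
      by (auto simp: sum_distrib_right intro!: sum.cong)
    also have "\<dots> = 0"
      using assms(2)[OF that] sum.image_gen[OF assms(1), of "\<lambda>j. c j * exp (- \<i> * of_real (k * t j))" t]
      by simp
    finally show ?thesis .
  qed
  from exp_sum_distinct_eq_0[OF _ this True] show ?thesis using assms(1) by simp
next
  case False
  then have "{j \<in> I. t j = s} = {}" by auto
  then show ?thesis by (simp only: sum.empty)
qed

section \<open>Directions in general position\<close>

text \<open>The plane orthogonal to \<open>d\<close> is the span of two basis vectors, which is the
  affine hull of these and 0.\<close>

lemma coplanar_hyperplane_0:
  fixes d :: "real^3"
  assumes "d \<noteq> 0" and "\<And>x. x \<in> S \<Longrightarrow> d \<bullet> x = 0"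
  shows "coplanar S"
proof -
  obtain B where B: "B \<subseteq> {x. d \<bullet> x = 0}" "independent B" "{x. d \<bullet> x = 0} \<subseteq> span B"
    "card B = dim {x. d \<bullet> x = 0}"
    using basis_exists by blast
  then have "card B = 2"
    using dim_hyperplane[OF assms(1)] by simp
  then obtain a b where "B = {a, b}" by (auto simp: card_2_iff)
  then have "S \<subseteq> affine hull {0, a, b}"
    using B(3) assms(2) by (auto simp: affine_hull_span_0 hull_inc span_insert_0)
  then show ?thesis unfolding coplanar_def by blast
qed

text \<open>For \<open>d\<close> the difference of two locations, this bounds the number of
  directions in which their projections agree.\<close>

lemma card_orthogonal_le_2:
  assumes "no_three_coplanar \<Theta>" and "d \<noteq> 0"
  shows "card {x \<in> \<Theta>. d \<bullet> x = 0} \<le> 2"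
proof (rule ccontr)
  assume "\<not> ?thesis"
  then have "3 \<le> card {x \<in> \<Theta>. d \<bullet> x = 0}" by simp
  then obtain T where T: "T \<subseteq> {x \<in> \<Theta>. d \<bullet> x = 0}" "card T = 3"
    by (rule obtain_subset_with_card_n)
  then obtain u v w where "T = {u, v, w}" "u \<noteq> v" "u \<noteq> w" "v \<noteq> w"
    by (auto simp: card_3_iff)
  moreover from this T have "coplanar {0, u, v, w}"
    by (intro coplanar_hyperplane_0[OF assms(2)]) auto
  ultimately show False
    using assms(1) T unfolding no_three_coplanar_def by blast
qed

text \<open>A third direction, available by the bound on the cardinality, would span a plane with
  the line through 0, \<open>u\<close> and \<open>v\<close>. In particular \<open>u\<close> and
  \<open>v\<close> cannot be antipodal.\<close>

lemma not_collinear_if_no_three_coplanar: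
  assumes "no_three_coplanar \<Theta>" and "3 \<le> card \<Theta>" and "u \<in> \<Theta>" "v \<in> \<Theta>" "u \<noteq> v"
  shows "\<not> collinear {0, u, v}"
proof
  assume "collinear {0, u, v}"
  have "\<not> \<Theta> \<subseteq> {u, v}"
    using card_mono[of "{u, v}" \<Theta>] assms by auto
  then obtain w where w: "w \<in> \<Theta>" "w \<noteq> u" "w \<noteq> v" by auto
  have "coplanar {0, u, v, w}"
  proof -
    obtain a b where "{0, u, v} \<subseteq> affine hull {a, b}"
      using \<open>collinear {0, u, v}\<close> unfolding collinear_affine_hull by blast
    then have "{0, u, v, w} \<subseteq> affine hull {a, b, w}"
      using hull_mono[of "{a, b}" "{a, b, w}" affine] by (auto simp: hull_inc)
    then show ?thesis unfolding coplanar_def by blast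
  qed
  moreover have "\<not> coplanar {0, u, v, w}"
    using assms(1,3-5) w unfolding no_three_coplanar_def by simp
  ultimately show False by simp
qed

section \<open>Algebra of the complex cross product\<close>

lemma ccross3_nth:
  "ccross3 a b $ 1 = a$2 * b$3 - a$3 * b$2"
  "ccross3 a b $ 2 = a$3 * b$1 - a$1 * b$3"
  "ccross3 a b $ 3 = a$1 * b$2 - a$2 * b$1"
  by (simp_all add: ccross3_def)

lemmas ccross3_simps = vec_eq_iff forall_3 ccross3_nth algebra_simps

lemma ccross3_minus_left: "ccross3 (- a) b = - ccross3 a b"
  and ccross3_minus_right: "ccross3 a (- b) = - ccross3 a b"
  and ccross3_diff_left: "ccross3 (a - b) d = ccross3 a d - ccross3 b d"
  and ccross3_diff_right: "ccross3 a (b - d) = ccross3 a b - ccross3 a d"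
  and ccross3_zero_right [simp]: "ccross3 a 0 = 0"
  by (simp_all add: ccross3_simps)

lemma ccross3_sum_left: "ccross3 (\<Sum>i\<in>I. f i) b = (\<Sum>i\<in>I. ccross3 (f i) b)"
  by (simp add: vec_eq_iff forall_3 ccross3_nth sum_subtractf sum_distrib_right)

lemma ccross3_sum_right: "ccross3 a (\<Sum>i\<in>I. f i) = (\<Sum>i\<in>I. ccross3 a (f i))"
  by (simp add: vec_eq_iff forall_3 ccross3_nth sum_subtractf sum_distrib_left)

lemma complex_vec_minus: "complex_vec (- x) = - complex_vec x"
  by (simp add: complex_vec_def vec_eq_iff)

(* For a unit vector x, x \<times> (x \<times> (a \<times> x)) = x \<times> a. *)
lemma ccross3_eq_0_if_electric_eq_0:
  assumes "norm x = 1" and "ccross3 (complex_vec x) (ccross3 a (complex_vec x)) = 0"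
  shows "ccross3 (complex_vec x) a = 0"
proof -
  define X where "X = complex_vec x"
  have unit: "X$1 * X$1 + X$2 * X$2 + X$3 * X$3 = 1"
  proof -
    have "x \<bullet> x = 1" using assms(1) by (simp add: norm_eq_sqrt_inner)
    then have "complex_of_real (x$1 * x$1 + x$2 * x$2 + x$3 * x$3) = 1"
      by (simp add: inner_vec_def sum_3)
    then show ?thesis by (simp add: X_def complex_vec_def)
  qed
  \<comment> \<open>A polynomial identity in the coordinates; its scalar is the bilinear square of
    \<open>X\<close>, which is 1 because \<open>x\<close> is a real unit vector.\<close>
  have "ccross3 X (ccross3 X (ccross3 a X)) = (X$1 * X$1 + X$2 * X$2 + X$3 * X$3) *s ccross3 X a"
    by (simp add: ccross3_simps)
  then have "ccross3 X a = ccross3 X (ccross3 X (ccross3 a X))" by (simp only: unit vec.scale_one)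
  then show ?thesis using assms(2) by (simp add: X_def)
qed

text \<open>As \<open>x\<close> is real, real and imaginary parts decouple, which makes the facts on
  the real \<open>cross3\<close> applicable.\<close>

lemma ccross3_complex_vec_eq_0_iff:
  "ccross3 (complex_vec x) a = 0 \<longleftrightarrow>
     cross3 x (\<chi> i. Re (a $ i)) = 0 \<and> cross3 x (\<chi> i. Im (a $ i)) = 0"
  by (auto simp: vec_eq_iff forall_3 ccross3_nth complex_vec_def complex_eq_iff cross3_def)

lemma eq_0_if_ccross3_eq_0:
  assumes "\<not> collinear {0, u, v}"
    and "ccross3 (complex_vec u) a = 0" "ccross3 (complex_vec v) a = 0"
  shows "a = 0"
proof -
  have real: "w = 0" if "cross3 u w = 0" "cross3 v w = 0" for w
    using that assms(1) collinear_3_trans[of u 0 w v] unfolding cross_eq_0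
    by (metis insert_commute)
  show ?thesis
    using assms(2,3) real[of "\<chi> i. Re (a $ i)"] real[of "\<chi> i. Im (a $ i)"]
    unfolding ccross3_complex_vec_eq_0_iff by (simp add: vec_eq_iff complex_eq_iff)
qed

section \<open>Isolating a location by counting directions\<close>

lemma projections_determine:
  fixes Q :: "real^3 \<Rightarrow> complex^3"
  assumes "finite \<Theta>" and "no_three_coplanar \<Theta>" and "3 \<le> card \<Theta>"
    and "finite Y" and "2 * card {y \<in> Y. Q y \<noteq> 0} \<le> card \<Theta>"
    and "\<And>x s. x \<in> \<Theta> \<Longrightarrow> ccross3 (complex_vec x) (\<Sum>y | y \<in> Y \<and> x \<bullet> y = s. Q y) = 0"
    and "y \<in> Y"
  shows "Q y = 0"
proof (rule ccontr)
  assume "Q y \<noteq> 0"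
  define S where "S = {y \<in> Y. Q y \<noteq> 0}"
  have S: "finite S" "y \<in> S" "2 * card S \<le> card \<Theta>"
    using assms \<open>Q y \<noteq> 0\<close> by (auto simp: S_def)
  \<comment> \<open>The bad directions: those in which another support point has the same projection
    as \<open>y\<close>.\<close>
  define B where "B = (\<Union>w\<in>S - {y}. {x \<in> \<Theta>. (w - y) \<bullet> x = 0})"
  have "card B \<le> (\<Sum>w\<in>S - {y}. card {x \<in> \<Theta>. (w - y) \<bullet> x = 0})"
    unfolding B_def using S by (intro card_UN_le) simp
  also have "\<dots> \<le> (\<Sum>w\<in>S - {y}. 2)"
    using assms(2) by (intro sum_mono card_orthogonal_le_2) auto
  \<comment> \<open>Leaving out \<open>y\<close> itself saves exactly the two directions that are
    needed below.\<close>
  also have "\<dots> = 2 * card S - 2" using S by simp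
  finally have "card B \<le> card \<Theta> - 2" using S by linarith
  moreover have "card (\<Theta> - B) = card \<Theta> - card B"
    by (intro card_Diff_subset finite_subset[OF _ assms(1)]) (auto simp: B_def)
  ultimately have "2 \<le> card (\<Theta> - B)" using assms(3) by linarith
  then obtain u v where uv: "u \<in> \<Theta> - B" "v \<in> \<Theta> - B" "u \<noteq> v"
    by (metis card_2_iff insert_subset obtain_subset_with_card_n)
  have "ccross3 (complex_vec x) (Q y) = 0" if x: "x \<in> \<Theta> - B" for x
  proof -
    \<comment> \<open>In a good direction every other term of the sum lies outside \<open>S\<close>
      and vanishes.\<close>
    have "(\<Sum>w | w \<in> Y \<and> x \<bullet> w = x \<bullet> y. Q w) = (\<Sum>w\<in>{y}. Q w)"
      using x assms(4,7)
      by (intro sum.mono_neutral_right)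
        (auto simp: S_def B_def inner_diff_right inner_commute)
    then show ?thesis using assms(6)[of x "x \<bullet> y"] x by simp
  qed
  then show False
    using uv \<open>Q y \<noteq> 0\<close> eq_0_if_ccross3_eq_0
      not_collinear_if_no_three_coplanar[OF assms(2,3)]
    by (metis DiffD1)
qed

section \<open>Dipole arrays as functions of the location\<close>

text \<open>The discrete vector measure of an array: a form independent of the numbering, in which
  arrays of different sizes can be subtracted.\<close>

definition dipole_density :: "nat set \<Rightarrow> (nat \<Rightarrow> real^3) \<Rightarrow> (nat \<Rightarrow> complex^3) \<Rightarrow> real^3 \<Rightarrow> complex^3" where
  "dipole_density I z q y = (\<Sum>m | m \<in> I \<and> z m = y. q m)"

lemma dipole_density_location:
  assumes "inj_on z I" and "m \<in> I"
  shows "dipole_density I z q (z m) = q m"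
proof -
  have "{n. n \<in> I \<and> z n = z m} = {m}"
    using assms by (auto simp: inj_on_def)
  then show ?thesis by (simp add: dipole_density_def)
qed

lemma dipole_density_eq_0: "y \<notin> z ` I \<Longrightarrow> dipole_density I z q y = 0"
  by (auto simp: dipole_density_def intro!: sum.neutral)

text \<open>Distinct locations prevent merging and nonzero strengths prevent loss, so the density
  carries exactly the set of pairs.\<close>

lemma graph_eq_dipole_density_support:
  assumes "inj_on z I" and "\<And>m. m \<in> I \<Longrightarrow> q m \<noteq> 0"
  shows "{(z m, q m) | m. m \<in> I} = {(y, dipole_density I z q y) | y. dipole_density I z q y \<noteq> 0}"
proof (intro subset_antisym subsetI)
  fix w assume "w \<in> {(z m, q m) | m. m \<in> I}"
  then obtain m where "w = (z m, q m)" "m \<in> I" by blast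
  then show "w \<in> {(y, dipole_density I z q y) | y. dipole_density I z q y \<noteq> 0}"
    using assms(2) dipole_density_location[OF assms(1), of m q] by auto
next
  fix w assume "w \<in> {(y, dipole_density I z q y) | y. dipole_density I z q y \<noteq> 0}"
  then obtain y where y: "w = (y, dipole_density I z q y)" "dipole_density I z q y \<noteq> 0" by blast
  then obtain m where "y = z m" "m \<in> I"
    using dipole_density_eq_0[of y z I q] by blast
  then show "w \<in> {(z m, q m) | m. m \<in> I}"
    using y dipole_density_location[OF assms(1), of m q] by auto
qed

text \<open>The factor 4 arises as 2 times 2: two arrays contribute to the support of the
  difference, and each support point spoils up to two directions.\<close>

lemma dipole_density_eq_if_projections_eq:
  assumes "finite \<Theta>" and "no_three_coplanar \<Theta>"
    and "finite I" "finite I'" and "4 * card I \<le> card \<Theta>" "4 * card I' \<le> card \<Theta>"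
    and "finite Y" and "z ` I \<subseteq> Y" "z' ` I' \<subseteq> Y"
    and "\<And>x s. x \<in> \<Theta> \<Longrightarrow>
      ccross3 (complex_vec x) (\<Sum>y | y \<in> Y \<and> x \<bullet> y = s. dipole_density I z q y - dipole_density I' z' q' y) = 0"
  shows "dipole_density I z q = dipole_density I' z' q'"
proof
  fix y
  let ?Q = "\<lambda>y. dipole_density I z q y - dipole_density I' z' q' y"
  show "dipole_density I z q y = dipole_density I' z' q' y"
  proof (cases "y \<in> z ` I \<union> z' ` I'")
    case True
    have "card {y \<in> Y. ?Q y \<noteq> 0} \<le> card (z ` I \<union> z' ` I')"
      using assms(3,4) dipole_density_eq_0[of _ z I q] dipole_density_eq_0[of _ z' I' q']
      by (intro card_mono) force+
    also have "\<dots> \<le> card I + card I'"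
      using card_Un_le card_image_le[OF assms(3)] card_image_le[OF assms(4)]
      by (meson add_mono order_trans)
    finally have "2 * card {y \<in> Y. ?Q y \<noteq> 0} \<le> card \<Theta>" using assms(5,6) by linarith
    \<comment> \<open>A location exists in this case, so \<open>\<Theta>\<close> has at least four
      elements; without dipoles it could be empty.\<close>
    moreover have "card I > 0 \<or> card I' > 0" using True assms(3,4) by (auto simp: card_gt_0_iff)
    then have "3 \<le> card \<Theta>" using assms(5,6) by linarith
    ultimately have "?Q y = 0"
      using True assms by (intro projections_determine[of \<Theta> Y ?Q]) auto
    then show ?thesis by simp
  qed (simp add: dipole_density_eq_0)
qed

section \<open>Amplitudes of the far field\<close>

text \<open>The coefficient of the exponential of one location, up to the common factor
  \<open>\<i> * k / (4 * pi)\<close>; \<open>a\<close> is the magnetic and \<open>b\<close> the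
  electric strength there.\<close>

definition field_amplitude :: "real^3 \<Rightarrow> complex^3 \<Rightarrow> complex^3 \<Rightarrow> complex^3" where
  "field_amplitude x a b =
     ccross3 (complex_vec x) a + ccross3 (complex_vec x) (ccross3 b (complex_vec x))"

lemma field_amplitude_diff:
  "field_amplitude x (a - a') (b - b') = field_amplitude x a b - field_amplitude x a' b'"
  by (simp add: field_amplitude_def ccross3_diff_left ccross3_diff_right)

lemma field_amplitude_sum:
  "field_amplitude x (\<Sum>i\<in>I. a i) (\<Sum>i\<in>I. b i) = (\<Sum>i\<in>I. field_amplitude x (a i) (b i))"
  by (simp add: field_amplitude_def ccross3_sum_left ccross3_sum_right sum.distrib)

text \<open>The magnetic term is odd in \<open>x\<close> and the electric term is even, so both
  vanish separately.\<close>

lemma field_amplitude_opposite_eq_0: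
  assumes "norm x = 1" and "field_amplitude x a b = 0" "field_amplitude (- x) a b = 0"
  shows "ccross3 (complex_vec x) a = 0" "ccross3 (complex_vec x) b = 0"
proof -
  let ?A = "ccross3 (complex_vec x) a"
    and ?B = "ccross3 (complex_vec x) (ccross3 b (complex_vec x))"
  have "?A + ?B = 0" "- ?A + ?B = 0"
    using assms(2,3)
    by (simp_all add: field_amplitude_def complex_vec_minus ccross3_minus_left ccross3_minus_right)
  then have "?A = 0" "?B = 0" by (simp_all add: vec_eq_iff)
  then show "?A = 0" "ccross3 (complex_vec x) b = 0"
    using ccross3_eq_0_if_electric_eq_0[OF assms(1)] by auto
qed

text \<open>A set \<open>Y\<close> larger than the set of locations is allowed so that two arrays
  can be expanded over the same points.\<close>

lemma far_field_dipole_density: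
  assumes "finite Y" and "z ` {1..M1} \<subseteq> Y" "z ` {M1<..M} \<subseteq> Y"
  shows "far_field M1 M z q x k = (\<i> * of_real k / (4 * of_real pi)) *s
    (\<Sum>y\<in>Y. exp (- \<i> * of_real (k * (x \<bullet> y))) *s
       field_amplitude x (dipole_density {1..M1} z q y) (dipole_density {M1<..M} z q y))"
proof -
  let ?X = "complex_vec x" and ?c = "\<i> * complex_of_real k / (4 * complex_of_real pi)"
    and ?e = "\<lambda>y. exp (- \<i> * complex_of_real (k * (x \<bullet> y)))"
  \<comment> \<open>Additivity of \<open>f\<close> is all that collecting dipoles by location
    requires, so both types are covered.\<close>
  have group: "(\<Sum>m\<in>I. (?c * ?e (z m)) *s f (q m)) =
      ?c *s (\<Sum>y\<in>Y. ?e y *s f (dipole_density I z q y))"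
    if "finite I" "z ` I \<subseteq> Y" and f: "\<And>(J :: nat set) g. f (\<Sum>m\<in>J. g m) = (\<Sum>m\<in>J. f (g m))"
    for I :: "nat set" and f :: "complex^3 \<Rightarrow> complex^3"
  proof -
    have "(\<Sum>m\<in>I. (?c * ?e (z m)) *s f (q m)) = (\<Sum>y\<in>Y. \<Sum>m | m \<in> I \<and> z m = y. (?c * ?e (z m)) *s f (q m))"
      by (rule sum.group[OF that(1) assms(1) that(2), symmetric])
    also have "\<dots> = ?c *s (\<Sum>y\<in>Y. ?e y *s f (dipole_density I z q y))"
      unfolding dipole_density_def f vec.scale_sum_right by (intro sum.cong refl) auto
    finally show ?thesis .
  qed
  have "far_field M1 M z q x k =
      (\<Sum>m\<in>{1..M1}. (?c * ?e (z m)) *s ccross3 ?X (q m)) +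
      (\<Sum>m\<in>{M1<..M}. (?c * ?e (z m)) *s ccross3 ?X (ccross3 (q m) ?X))"
    by (simp add: far_field_def)
  also have "\<dots> = ?c *s (\<Sum>y\<in>Y. ?e y *s ccross3 ?X (dipole_density {1..M1} z q y)) +
      ?c *s (\<Sum>y\<in>Y. ?e y *s ccross3 ?X (ccross3 (dipole_density {M1<..M} z q y) ?X))"
    using assms(2,3)
    by (simp only: group[of _ "ccross3 ?X"] group[of _ "\<lambda>a. ccross3 ?X (ccross3 a ?X)"]
        ccross3_sum_left ccross3_sum_right finite_atLeastAtMost finite_greaterThanAtMost)
  also have "\<dots> = ?c *s (\<Sum>y\<in>Y. ?e y *s field_amplitude x (dipole_density {1..M1} z q y) (dipole_density {M1<..M} z q y))"
    by (simp add: field_amplitude_def vec.scale_right_distrib sum.distrib)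
  finally show ?thesis .
qed

lemma projected_amplitude_eq_0:
  assumes "finite Y" and "z ` {1..M1} \<subseteq> Y" "z ` {M1<..M} \<subseteq> Y"
    and "z' ` {1..M1'} \<subseteq> Y" "z' ` {M1'<..M'} \<subseteq> Y"
    and "\<And>k. k > 0 \<Longrightarrow> far_field M1 M z q x k = far_field M1' M' z' q' x k"
  shows "field_amplitude x
      (\<Sum>y | y \<in> Y \<and> x \<bullet> y = s. dipole_density {1..M1} z q y - dipole_density {1..M1'} z' q' y)
      (\<Sum>y | y \<in> Y \<and> x \<bullet> y = s. dipole_density {M1<..M} z q y - dipole_density {M1'<..M'} z' q' y) = 0"
proof -
  let ?F = "\<lambda>y. field_amplitude x (dipole_density {1..M1} z q y - dipole_density {1..M1'} z' q' y)
      (dipole_density {M1<..M} z q y - dipole_density {M1'<..M'} z' q' y)"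
  have "(\<Sum>y | y \<in> Y \<and> x \<bullet> y = s. ?F y $ i) = 0" for i
  proof (rule exp_sum_eq_0[OF assms(1)])
    fix k :: real assume k: "k > 0"
    \<comment> \<open>The common factor of the two fields is nonzero for \<open>k > 0\<close> and
      cancels.\<close>
    have "(\<Sum>y\<in>Y. exp (- \<i> * of_real (k * (x \<bullet> y))) *s ?F y) = 0"
      using assms(6)[OF k] k
      unfolding far_field_dipole_density[OF assms(1-3)] far_field_dipole_density[OF assms(1,4,5)]
      by (simp add: field_amplitude_diff vec.scale_right_diff_distrib sum_subtractf)
    then show "(\<Sum>y\<in>Y. ?F y $ i * exp (- \<i> * of_real (k * (x \<bullet> y)))) = 0"
      by (simp add: vec_eq_iff mult.commute)
  qed
  then show ?thesis by (simp add: field_amplitude_sum vec_eq_iff)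
qed

lemma polarization_strength_nonzero:
  assumes "dipole_array M1 M z \<tau> p" and "m \<in> {1..M}"
  shows "polarization_strength \<tau> p m \<noteq> 0"
proof -
  have "\<tau> m \<noteq> 0" "p m \<noteq> 0"
    using assms by (force simp: dipole_array_def)+
  then show ?thesis
    by (auto simp: polarization_strength_def complex_vec_def vec_eq_iff)
qed

section \<open>Unique determination of the magnetic and electric dipoles\<close>

theorem theorem3p4:
  fixes \<Theta> :: "(real^3) set" and L M1 M M1' M' :: nat
    and z z' :: "nat \<Rightarrow> real^3" and \<tau> \<tau>' :: "nat \<Rightarrow> complex" and p p' :: "nat \<Rightarrow> real^3"
    and q q' :: "nat \<Rightarrow> complex^3"
  assumes "\<Theta> \<subseteq> sphere 0 1" and "finite \<Theta>" and "card \<Theta> = L"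
    and "no_three_coplanar \<Theta>"
    and "dipole_array M1 M z \<tau> p" and "q = polarization_strength \<tau> p"
    and "dipole_array M1' M' z' \<tau>' p'" and "q' = polarization_strength \<tau>' p'"
    and "L \<ge> max (4 * M1) (4 * (M - M1))"
    and "L \<ge> max (4 * M1') (4 * (M' - M1'))"
    and "\<forall>x\<in>\<Theta>. \<forall>k>0. far_field M1 M z q x k = far_field M1' M' z' q' x k
                      \<and> far_field M1 M z q (- x) k = far_field M1' M' z' q' (- x) k"
  shows "{(z m, q m) | m. 1 \<le> m \<and> m \<le> M1} = {(z' m, q' m) | m. 1 \<le> m \<and> m \<le> M1'} \<and>
         {(z m, q m) | m. M1 < m \<and> m \<le> M} = {(z' m, q' m) | m. M1' < m \<and> m \<le> M'}"
proof -
  define Y where "Y = z ` {1..M1} \<union> z ` {M1<..M} \<union> z' ` {1..M1'} \<union> z' ` {M1'<..M'}"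
  have Y: "finite Y" "z ` {1..M1} \<subseteq> Y" "z ` {M1<..M} \<subseteq> Y" "z' ` {1..M1'} \<subseteq> Y" "z' ` {M1'<..M'} \<subseteq> Y"
    by (auto simp: Y_def)
  let ?a = "\<lambda>y. dipole_density {1..M1} z q y - dipole_density {1..M1'} z' q' y"
    and ?b = "\<lambda>y. dipole_density {M1<..M} z q y - dipole_density {M1'<..M'} z' q' y"
  have projections:
    "ccross3 (complex_vec x) (\<Sum>y | y \<in> Y \<and> x \<bullet> y = s. ?a y) = 0"
    "ccross3 (complex_vec x) (\<Sum>y | y \<in> Y \<and> x \<bullet> y = s. ?b y) = 0" if x: "x \<in> \<Theta>" for x s
  proof -
    have "norm x = 1" using x assms(1) by auto
    moreover have "field_amplitude x (\<Sum>y | y \<in> Y \<and> x \<bullet> y = s. ?a y) (\<Sum>y | y \<in> Y \<and> x \<bullet> y = s. ?b y) = 0"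
      using assms(11) x by (intro projected_amplitude_eq_0[OF Y]) auto
    \<comment> \<open>Projection \<open>- s\<close> along \<open>- x\<close> selects the same
      locations as \<open>s\<close> along \<open>x\<close>, so the amplitudes at opposite directions
      have the same arguments.\<close>
    moreover have "field_amplitude (- x) (\<Sum>y | y \<in> Y \<and> - x \<bullet> y = - s. ?a y)
        (\<Sum>y | y \<in> Y \<and> - x \<bullet> y = - s. ?b y) = 0"
      using assms(11) x by (intro projected_amplitude_eq_0[OF Y]) auto
    ultimately show
      "ccross3 (complex_vec x) (\<Sum>y | y \<in> Y \<and> x \<bullet> y = s. ?a y) = 0"
      "ccross3 (complex_vec x) (\<Sum>y | y \<in> Y \<and> x \<bullet> y = s. ?b y) = 0"
      using field_amplitude_opposite_eq_0[of x "\<Sum>y | y \<in> Y \<and> x \<bullet> y = s. ?a y"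
          "\<Sum>y | y \<in> Y \<and> x \<bullet> y = s. ?b y"] by simp_all
  qed
  have "dipole_density {1..M1} z q = dipole_density {1..M1'} z' q'"
    using assms(3,9,10) projections(1)
    by (intro dipole_density_eq_if_projections_eq[OF assms(2,4) _ _ _ _ Y(1,2,4)]) auto
  moreover have "dipole_density {M1<..M} z q = dipole_density {M1'<..M'} z' q'"
    using assms(3,9,10) projections(2)
    by (intro dipole_density_eq_if_projections_eq[OF assms(2,4) _ _ _ _ Y(1,3,5)]) auto
  moreover have
    "inj_on z {1..M1}" "inj_on z {M1<..M}" "inj_on z' {1..M1'}" "inj_on z' {M1'<..M'}"
    "M1 \<le> M" "M1' \<le> M'"
    using assms(5,7) by (auto simp: dipole_array_def)
  moreover from this have
    "\<And>m. m \<in> {1..M1} \<Longrightarrow> q m \<noteq> 0" "\<And>m. m \<in> {M1<..M} \<Longrightarrow> q m \<noteq> 0"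
    "\<And>m. m \<in> {1..M1'} \<Longrightarrow> q' m \<noteq> 0" "\<And>m. m \<in> {M1'<..M'} \<Longrightarrow> q' m \<noteq> 0"
    using polarization_strength_nonzero[OF assms(5)] polarization_strength_nonzero[OF assms(7)]
    by (auto simp: assms(6,8))
  ultimately have
    "{(z m, q m) | m. m \<in> {1..M1}} = {(z' m, q' m) | m. m \<in> {1..M1'}}"
    "{(z m, q m) | m. m \<in> {M1<..M}} = {(z' m, q' m) | m. m \<in> {M1'<..M'}}"
    using graph_eq_dipole_density_support[of z "{1..M1}" q] graph_eq_dipole_density_support[of z "{M1<..M}" q]
      graph_eq_dipole_density_support[of z' "{1..M1'}" q'] graph_eq_dipole_density_support[of z' "{M1'<..M'}" q']
    by simp_all
  then show ?thesis by simp
qed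

end
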